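(* Let $\mu_1\ge\mu_2>0$, $A\in\mathbb{R}^{m\times n}$, $b\in\mathbb{R}^m$, and let $H_1,H_2$ be proper closed convex functions on $\mathbb{R}^n$ for which there exists a norm $\rho$ on $\mathbb{R}^n$ with $0\le H_2(z)\le\min\{\rho(z),H_1(z)\}$ for all $z$. The function $$J(z):=\frac12\|Az-b\|^2+\mu_1H_1(z)-\mu_2H_2(z)$$ is coercive when either of the following holds: (a) $\mu_1>\mu_2$ and $H_1$ is level bounded; or (b) $\mu_1=\mu_2$, and $H_1$ and $H_2$ are norms such that $H_1(z)>H_2(z)$ whenever $\|z\|_0\ge r_A+1$, where $r_A=\max\{i:\ \text{any } i \text{ columns of } A \text{ are linearly independent}\}$.
   Context: $\|\cdot\|$ is the Euclidean norm and $\|z\|_0$ is the number of nonzero entries of $z$. In the definition of $r_A$, $i$ ranges over $\{0,1,\dots,n\}$ (so $r_A=0$ if $A$ has a zero column). A proper closed function $g$ is level bounded if $\{z:g(z)\le r\}$ is bounded for every $r\in\mathbb{R}$, and is coercive if $\liminf_{\|z\|\to\infty}g(z)/\|z\|>0$. *)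

theory Defs
  imports "HOL-Analysis.Analysis"
begin

definition proper_fun :: "('a \<Rightarrow> ereal) \<Rightarrow> bool" where
  "proper_fun f \<longleftrightarrow> (\<forall>x. f x \<noteq> -\<infinity>) \<and> (\<exists>x. f x \<noteq> \<infinity>)"

(* The library's epigraph is for real-valued functions; heights are real here as well,
   only the function values are extended. *)
definition ereal_epigraph :: "('a \<Rightarrow> ereal) \<Rightarrow> ('a \<times> real) set" where
  "ereal_epigraph f = {(x, t). f x \<le> ereal t}"

definition closed_fun :: "('a::topological_space \<Rightarrow> ereal) \<Rightarrow> bool" where
  "closed_fun f \<longleftrightarrow> closed (ereal_epigraph f)"

definition convex_fun :: "('a::real_vector \<Rightarrow> ereal) \<Rightarrow> bool" where
  "convex_fun f \<longleftrightarrow> convex (ereal_epigraph f)"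

definition is_norm :: "('a::real_vector \<Rightarrow> real) \<Rightarrow> bool" where
  "is_norm N \<longleftrightarrow>
     (\<forall>x. 0 \<le> N x) \<and> (\<forall>x. N x = 0 \<longleftrightarrow> x = 0) \<and>
     (\<forall>c x. N (c *\<^sub>R x) = \<bar>c\<bar> * N x) \<and>
     (\<forall>x y. N (x + y) \<le> N x + N y)"

definition is_ereal_norm :: "('a::real_vector \<Rightarrow> ereal) \<Rightarrow> bool" where
  "is_ereal_norm f \<longleftrightarrow> (\<exists>N. is_norm N \<and> f = (\<lambda>x. ereal (N x)))"

(* Level boundedness and coercivity are notions for proper closed functions, so these
   requirements are part of the definitions. *)
definition level_bounded :: "('a::real_normed_vector \<Rightarrow> ereal) \<Rightarrow> bool" where
  "level_bounded g \<longleftrightarrow> proper_fun g \<and> closed_fun g \<and> (\<forall>r::real. bounded {z. g z \<le> ereal r})"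

definition coercive :: "('a::real_normed_vector \<Rightarrow> ereal) \<Rightarrow> bool" where
  "coercive g \<longleftrightarrow> proper_fun g \<and> closed_fun g \<and>
     Liminf at_infinity (\<lambda>z. g z / ereal (norm z)) > 0"

definition l0norm :: "real ^ 'n \<Rightarrow> nat" where
  "l0norm z = card {i. z $ i \<noteq> 0}"

(* Linear independence of the columns indexed by S, as a family: injectivity is needed because
   equal columns with different indices are dependent but collapse in the image. *)
definition columns_independent :: "real ^ 'n ^ 'm \<Rightarrow> 'n set \<Rightarrow> bool" where
  "columns_independent A S \<longleftrightarrow>
     inj_on (\<lambda>j. column j A) S \<and> independent ((\<lambda>j. column j A) ` S)"

(* The bound i \<le> n is needed: beyond it the condition holds vacuously. *)
definition r_col :: "real ^ 'n ^ 'm \<Rightarrow> nat" where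
  "r_col A = Max {i \<in> {0..CARD('n)}. \<forall>S. card S = i \<longrightarrow> columns_independent A S}"

(* In ereal, \<infinity> - \<infinity> = \<infinity>; this convention is irrelevant whenever H2 is finite. *)
definition J_fun :: "real ^ 'n ^ 'm \<Rightarrow> real ^ 'm \<Rightarrow> real \<Rightarrow> real \<Rightarrow>
    (real ^ 'n \<Rightarrow> ereal) \<Rightarrow> (real ^ 'n \<Rightarrow> ereal) \<Rightarrow> real ^ 'n \<Rightarrow> ereal" where
  "J_fun A b \<mu>1 \<mu>2 H1 H2 z =
     ereal (1 / 2 * (norm (A *v z - b))\<^sup>2) + ereal \<mu>1 * H1 z - ereal \<mu>2 * H2 z"

end

theory Submission
  imports Defs
begin

text \<open>The function \<open>J\<close> is bounded below by \<open>c * norm z - d\<close> with \<open>c > 0\<close>. In case (a), \<open>H2 \<le> H1\<close> gives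
  \<open>J \<ge> (\<mu>1 - \<mu>2) * H1\<close>, and a convex level bounded function grows at least linearly along rays
  leaving a point of its domain. In case (b), \<open>H1 z - H2 z + norm (A *v z)\<close> is nonnegative,
  absolutely homogeneous and vanishes only at 0, because a nonzero kernel vector of \<open>A\<close> has more
  than \<open>r_col A\<close> nonzero entries; hence it dominates a multiple of the norm by compactness of the
  sphere, and the quadratic term dominates \<open>\<mu>1 * norm (A *v z)\<close> up to a constant.\<close>

section \<open>A criterion for coercivity\<close>

lemma coercive_if_linear_bound:
  fixes f :: "'a::real_normed_vector \<Rightarrow> ereal"
  assumes "proper_fun f" "closed_fun f" "c > 0"
    and bound: "\<And>z. f z \<ge> ereal (c * norm z - d)"
  shows "coercive f"
proof -
  have "\<forall>\<^sub>F z in at_infinity. ereal (c / 2) \<le> f z / ereal (norm z)"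
    unfolding eventually_at_infinity
  proof (intro exI allI impI)
    \<comment> \<open>Beyond \<open>2 * d / c\<close> the constant \<open>d\<close> uses up at most
      half of the slope \<open>c\<close>, which leaves \<open>c / 2\<close>. The bound 1 keeps
      \<open>norm z\<close> positive, so that one may divide by it.\<close>
    fix z :: 'a assume z: "norm z \<ge> max 1 (2 * d / c)"
    then have pos: "norm z > 0" by linarith
    from z have "c * norm z \<ge> 2 * d"
      using \<open>c > 0\<close> by (simp add: field_simps)
    then have "ereal (c / 2 * norm z) \<le> ereal (c * norm z - d)"
      by simp
    also have "\<dots> \<le> f z" by (rule bound)
    finally show "ereal (c / 2) \<le> f z / ereal (norm z)"
      using pos by (simp add: ereal_le_divide_pos mult.commute)
  qed
  then have "ereal (c / 2) \<le> Liminf at_infinity (\<lambda>z. f z / ereal (norm z))"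
    by (rule Liminf_bounded)
  moreover have "0 < ereal (c / 2)" using \<open>c > 0\<close> by simp
  ultimately show ?thesis
    using assms(1,2) unfolding coercive_def by (meson order_less_le_trans)
qed

section \<open>Convex functions: continuity and linear growth\<close>

lemma convex_fun_ineq:
  assumes "convex_fun f" "f x \<le> ereal s" "f y \<le> ereal t" "0 \<le> u" "u \<le> 1"
  shows "f ((1 - u) *\<^sub>R x + u *\<^sub>R y) \<le> ereal ((1 - u) * s + u * t)"
proof -
  have "(1 - u) *\<^sub>R (x, s) + u *\<^sub>R (y, t) \<in> ereal_epigraph f"
    by (rule convexD) (use assms in \<open>auto simp: convex_fun_def ereal_epigraph_def\<close>)
  then show ?thesis by (simp add: ereal_epigraph_def)
qed

text \<open>Passes from the epigraph to the library notion of convexity, from which continuity of a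
  finite convex function follows in finite dimension.\<close>

lemma convex_fun_ereal_imp_convex_on:
  assumes "convex_fun (\<lambda>x. ereal (h x))"
  shows "convex_on UNIV h"
proof (rule convex_onI)
  fix t x y assume "0 < t" "t < (1::real)"
  then show "h ((1 - t) *\<^sub>R x + t *\<^sub>R y) \<le> (1 - t) * h x + t * h y"
    using convex_fun_ineq[OF assms, of x "h x" y "h y" t] by simp
qed simp

text \<open>Homogeneity and the triangle inequality make \<open>N\<close> convex, and a finite
  convex function on a Euclidean space is continuous.\<close>

lemma is_norm_continuous:
  fixes N :: "'a::euclidean_space \<Rightarrow> real"
  assumes "is_norm N"
  shows "continuous_on UNIV N"
proof -
  have "convex_on UNIV N"
  proof (rule convex_onI)
    fix t x y assume "0 < t" "t < (1::real)"
    then show "N ((1 - t) *\<^sub>R x + t *\<^sub>R y) \<le> (1 - t) * N x + t * N y"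
      using assms unfolding is_norm_def
      by (metis abs_of_pos diff_gt_0_iff_gt)
  qed simp
  then show ?thesis by (intro convex_on_continuous) auto
qed

text \<open>On a large sphere around a point \<open>x0\<close> of the domain, \<open>H\<close>
  exceeds its value at \<open>x0\<close> by more than 1. By convexity it keeps rising at least at
  that average rate along every ray beyond the sphere.\<close>

lemma level_bounded_convex_linear_growth:
  fixes H :: "'a::real_normed_vector \<Rightarrow> ereal"
  assumes lb: "level_bounded H" and conv: "convex_fun H" and nonneg: "\<And>z. 0 \<le> H z"
  obtains c d where "c > 0" "\<And>z. H z \<ge> ereal (c * norm z - d)"
proof -
  from lb obtain x0 where "H x0 \<noteq> \<infinity>" "H x0 \<noteq> -\<infinity>"
    unfolding level_bounded_def proper_fun_def by blast
  then obtain h0 where h0: "H x0 = ereal h0" by (cases "H x0") auto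
  have h0_nonneg: "h0 \<ge> 0" using nonneg[of x0] h0 by simp
  have "bounded {z. H z \<le> ereal (h0 + 1)}"
    using lb unfolding level_bounded_def by blast
  then obtain r where r: "\<And>z. H z \<le> ereal (h0 + 1) \<Longrightarrow> dist x0 z \<le> r"
    unfolding bounded_any_center[where a = x0] by blast
  \<comment> \<open>The summand 1 places the sphere of radius \<open>R\<close> strictly outside a
    ball that contains the sublevel set.\<close>
  define R where "R = max r 0 + 1"
  have "R > 0" unfolding R_def by simp
  have outside: "H z > ereal (h0 + 1)" if "dist x0 z = R" for z
    using r[of z] that unfolding R_def by (force simp: not_le[symmetric])
  \<comment> \<open>The \<open>- 1\<close> makes the left side nonpositive within distance
    \<open>R\<close> of \<open>x0\<close>, where \<open>H\<close> is only known to be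
    nonnegative.\<close>
  have growth: "ereal (norm (z - x0) / R - 1) \<le> H z" for z
  proof (cases "norm (z - x0) \<le> R \<or> H z = \<infinity>")
    case True
    then show ?thesis
    proof
      assume "norm (z - x0) \<le> R"
      then have "ereal (norm (z - x0) / R - 1) \<le> 0"
        using \<open>R > 0\<close> by (simp add: zero_ereal_def field_simps)
      then show ?thesis using nonneg[of z] by (rule order_trans)
    qed simp
  next
    case False
    then obtain h where h: "H z = ereal h"
      using nonneg[of z] by (cases "H z") auto
    \<comment> \<open>With this \<open>u\<close>, the point \<open>w\<close> below is where the
      segment from \<open>x0\<close> to \<open>z\<close> crosses the sphere of radius
      \<open>R\<close>.\<close>
    define u where "u = R / norm (z - x0)"
    have far: "0 < norm (z - x0)" "R \<le> norm (z - x0)" using False \<open>R > 0\<close> by linarith+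
    have u: "0 < u" "u \<le> 1"
      using far \<open>R > 0\<close> unfolding u_def by simp_all
    define w where "w = (1 - u) *\<^sub>R x0 + u *\<^sub>R z"
    have "w - x0 = u *\<^sub>R (z - x0)" unfolding w_def by (simp add: algebra_simps)
    then have "dist x0 w = R"
      using far \<open>R > 0\<close> unfolding u_def dist_norm norm_minus_commute[of x0]
      by auto
    then have "ereal (h0 + 1) < H w" by (rule outside)
    also have "\<dots> \<le> ereal ((1 - u) * h0 + u * h)"
      unfolding w_def by (rule convex_fun_ineq) (use conv h h0 u in auto)
    finally have "1 < u * (h - h0)" by (simp add: algebra_simps)
    then have "1 / u < h - h0" using u by (simp add: field_simps)
    moreover have "1 / u = norm (z - x0) / R" unfolding u_def by simp
    ultimately show ?thesis using h h0_nonneg by simp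
  qed
  show thesis
  proof
    show "1 / R > 0" using \<open>R > 0\<close> by simp
    fix z
    have "norm z \<le> norm (z - x0) + norm x0" by (metis diff_add_cancel norm_triangle_ineq)
    then have "norm z / R \<le> (norm (z - x0) + norm x0) / R"
      using \<open>R > 0\<close> by (intro divide_right_mono) auto
    then have "1 / R * norm z - (norm x0 / R + 1) \<le> norm (z - x0) / R - 1"
      by (simp add: add_divide_distrib)
    then show "ereal (1 / R * norm z - (norm x0 / R + 1)) \<le> H z"
      using growth[of z] order_trans ereal_less_eq(3) by blast
  qed
qed

section \<open>Kernel vectors and absolutely homogeneous functions\<close>

lemma r_col_le: "r_col A \<le> CARD('n)"
  and r_col_independent: "card S = r_col A \<Longrightarrow> columns_independent A S"
  for A :: "real ^ 'n ^ 'm"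
proof -
  let ?X = "{i \<in> {0..CARD('n)}. \<forall>S. card S = i \<longrightarrow> columns_independent A S}"
  \<comment> \<open>The empty family of columns is independent, so the set is nonempty and its
    maximum is attained.\<close>
  have "0 \<in> ?X" by (auto simp: columns_independent_def independent_empty)
  then have "r_col A \<in> ?X" unfolding r_col_def by (intro Max_in) auto
  then show "r_col A \<le> CARD('n)" "card S = r_col A \<Longrightarrow> columns_independent A S" by auto
qed

text \<open>\<open>A *v z\<close> is the combination of the columns with the entries of
  \<open>z\<close> as coefficients, and only columns indexed by \<open>S\<close> contribute.\<close>

lemma columns_independent_kernel:
  fixes A :: "real ^ 'n ^ 'm"
  assumes indep: "columns_independent A S" and supp: "{i. z $ i \<noteq> 0} \<subseteq> S" and ker: "A *v z = 0"
  shows "z = 0"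
proof -
  let ?f = "\<lambda>j. column j A"
  \<comment> \<open>Independence speaks of a set of vectors, so a coefficient must depend on the
    vector; \<open>?g\<close> recovers the index of a column.\<close>
  let ?g = "the_inv_into S ?f"
  have inj: "inj_on ?f S" and ind: "independent (?f ` S)"
    using indep unfolding columns_independent_def by auto
  have "(\<Sum>v\<in>?f ` S. z $ ?g v *\<^sub>R v) = (\<Sum>j\<in>S. z $ j *\<^sub>R ?f j)"
    using inj by (simp add: sum.reindex the_inv_into_f_f[OF inj])
  also have "\<dots> = (\<Sum>j\<in>UNIV. z $ j *\<^sub>R ?f j)"
    using supp by (intro sum.mono_neutral_left) auto
  also have "\<dots> = A *v z" by (simp add: matrix_mult_sum scalar_mult_eq_scaleR)
  finally have "(\<Sum>v\<in>?f ` S. z $ ?g v *\<^sub>R v) = 0" using ker by simp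
  then have "z $ ?g v = 0" if "v \<in> ?f ` S" for v
    using independentD[OF ind, of "?f ` S" "\<lambda>v. z $ ?g v" v] that by simp
  then have "z $ j = 0" if "j \<in> S" for j
    using that the_inv_into_f_f[OF inj that] by force
  then show ?thesis using supp by (auto simp: vec_eq_iff)
qed

text \<open>A support of at most \<open>r_col A\<close> indices extends to a set of exactly
  \<open>r_col A\<close> indices, whose columns are independent by the choice of
  \<open>r_col A\<close>.\<close>

lemma kernel_l0norm:
  fixes A :: "real ^ 'n ^ 'm"
  assumes "A *v z = 0" "z \<noteq> 0"
  shows "l0norm z \<ge> r_col A + 1"
proof (rule ccontr)
  assume "\<not> ?thesis"
  then have "card {i. z $ i \<noteq> 0} \<le> r_col A" unfolding l0norm_def by simp
  then obtain S where "{i. z $ i \<noteq> 0} \<subseteq> S" "card S = r_col A"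
    using exists_subset_between[of "{i. z $ i \<noteq> 0}" "r_col A" UNIV] r_col_le[of A] by auto
  then show False
    using columns_independent_kernel r_col_independent assms by blast
qed

text \<open>The minimum of \<open>G\<close> on the unit sphere is attained, hence positive, and
  homogeneity carries it to all vectors. The triangle inequality is not assumed, so that
  \<open>G\<close> may contain a difference of norms.\<close>

lemma homogeneous_lower_bound:
  fixes G :: "'a::euclidean_space \<Rightarrow> real"
  assumes cont: "continuous_on UNIV G"
    and hom: "\<And>c z. G (c *\<^sub>R z) = \<bar>c\<bar> * G z"
    and pos: "\<And>z. z \<noteq> 0 \<Longrightarrow> G z > 0"
  obtains c where "c > 0" "\<And>z. G z \<ge> c * norm z"
proof -
  obtain x where x: "x \<in> sphere 0 1" "\<And>y. y \<in> sphere 0 1 \<Longrightarrow> G x \<le> G y"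
    using continuous_attains_inf[of "sphere (0::'a) 1" G] continuous_on_subset[OF cont] by auto
  show thesis
  proof
    show "G x > 0" using x(1) by (intro pos) auto
    fix z
    show "G x * norm z \<le> G z"
    proof (cases "z = 0")
      case True
      then show ?thesis using hom[of 0 z] by simp
    next
      case False
      then have "G x \<le> G ((1 / norm z) *\<^sub>R z)" by (intro x(2)) simp
      also have "\<dots> = G z / norm z" by (simp only: hom) simp
      finally show ?thesis using False by (simp add: field_simps)
    qed
  qed
qed

section \<open>Properness and closedness of \<open>J_fun\<close>\<close>

lemma J_fun_proper:
  assumes "proper_fun H1" "\<mu>1 > 0" "\<And>z. 0 \<le> H1 z"
  shows "proper_fun (J_fun A b \<mu>1 \<mu>2 H1 (\<lambda>z. ereal (h2 z)))"
  unfolding proper_fun_def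
proof
  show "\<forall>x. J_fun A b \<mu>1 \<mu>2 H1 (\<lambda>z. ereal (h2 z)) x \<noteq> - \<infinity>"
  proof
    fix x
    show "J_fun A b \<mu>1 \<mu>2 H1 (\<lambda>z. ereal (h2 z)) x \<noteq> - \<infinity>"
      using assms(2) assms(3)[of x] by (cases "H1 x") (auto simp: J_fun_def)
  qed
  obtain x where "H1 x \<noteq> \<infinity>" using assms(1) unfolding proper_fun_def by blast
  then have "J_fun A b \<mu>1 \<mu>2 H1 (\<lambda>z. ereal (h2 z)) x \<noteq> \<infinity>"
    using assms(3)[of x] by (cases "H1 x") (auto simp: J_fun_def)
  then show "\<exists>x. J_fun A b \<mu>1 \<mu>2 H1 (\<lambda>z. ereal (h2 z)) x \<noteq> \<infinity>" ..
qed

text \<open>The epigraph is the preimage of the epigraph of \<open>H1\<close> under a continuous map.\<close>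

lemma J_fun_closed:
  assumes "closed_fun H1" "\<mu>1 > 0" "\<And>z. 0 \<le> H1 z" and h2: "continuous_on UNIV h2"
  shows "closed_fun (J_fun A b \<mu>1 \<mu>2 H1 (\<lambda>z. ereal (h2 z)))"
proof -
  \<comment> \<open>The second component results from solving the inequality between
    \<open>J_fun\<close> and the height for \<open>H1\<close>; dividing by \<mu>1 > 0 preserves its
    direction.\<close>
  define \<phi> where "\<phi> = (\<lambda>p. (fst p,
      (snd p - 1 / 2 * (norm (A *v fst p - b))\<^sup>2 + \<mu>2 * h2 (fst p)) / \<mu>1))"
  have "continuous_on UNIV \<phi>"
    unfolding \<phi>_def using \<open>\<mu>1 > 0\<close>
    by (intro continuous_intros continuous_on_compose2[OF h2]
        matrix_vector_mult_linear_continuous_on[THEN continuous_on_compose2]) auto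
  moreover have "ereal_epigraph (J_fun A b \<mu>1 \<mu>2 H1 (\<lambda>z. ereal (h2 z))) =
      \<phi> -` ereal_epigraph H1"
  proof -
    have "J_fun A b \<mu>1 \<mu>2 H1 (\<lambda>z. ereal (h2 z)) x \<le> ereal t \<longleftrightarrow>
        H1 x \<le> ereal ((t - 1 / 2 * (norm (A *v x - b))\<^sup>2 + \<mu>2 * h2 x) / \<mu>1)" for x t
      using \<open>\<mu>1 > 0\<close> assms(3)[of x] by (cases "H1 x") (auto simp: J_fun_def field_simps)
    then show ?thesis unfolding ereal_epigraph_def \<phi>_def by auto
  qed
  ultimately show ?thesis
    using assms(1) unfolding closed_fun_def by (auto intro: closed_vimage)
qed

section \<open>Lower bounds for \<open>J_fun\<close> in the two cases\<close>

lemma J_fun_bound_strict: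
  assumes "\<mu>1 > \<mu>2" "\<mu>2 > 0" "0 \<le> h2 z" "ereal (h2 z) \<le> H1 z" "ereal t \<le> H1 z"
  shows "J_fun A b \<mu>1 \<mu>2 H1 (\<lambda>z. ereal (h2 z)) z \<ge> ereal ((\<mu>1 - \<mu>2) * t)"
proof (cases "H1 z")
  case (real r)
  \<comment> \<open>Of the weight \<mu>1 on \<open>H1\<close>, the share \<mu>2 pays for the
    subtracted term, and the rest carries the lower bound \<open>t\<close>.\<close>
  have "(\<mu>1 - \<mu>2) * t \<le> (\<mu>1 - \<mu>2) * r" "\<mu>2 * h2 z \<le> \<mu>2 * r"
    using assms real by (auto intro!: mult_left_mono)
  then have "(\<mu>1 - \<mu>2) * t \<le> \<mu>1 * r - \<mu>2 * h2 z" by (simp add: algebra_simps)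
  moreover have "0 \<le> (norm (A *v z - b))\<^sup>2" by simp
  ultimately have "(\<mu>1 - \<mu>2) * t \<le> 1 / 2 * (norm (A *v z - b))\<^sup>2 + \<mu>1 * r - \<mu>2 * h2 z"
    by linarith
  then show ?thesis using real by (simp add: J_fun_def)
qed (use assms in \<open>auto simp: J_fun_def\<close>)

lemma J_fun_bound_norms:
  fixes A :: "real ^ 'n ^ 'm"
  assumes "\<mu> > 0" "is_norm N1" "is_norm N2" and le: "\<And>z. N2 z \<le> N1 z"
    and less: "\<And>z. l0norm z \<ge> r_col A + 1 \<Longrightarrow> N2 z < N1 z"
  obtains c d where "c > 0"
    "\<And>z. J_fun A b \<mu> \<mu> (\<lambda>z. ereal (N1 z)) (\<lambda>z. ereal (N2 z)) z \<ge> ereal (c * norm z - d)"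
proof -
  define G where "G z = N1 z - N2 z + norm (A *v z)" for z
  obtain c where c: "c > 0" "\<And>z. G z \<ge> c * norm z"
  proof (rule homogeneous_lower_bound[of G])
    show "continuous_on UNIV G"
      unfolding G_def
      by (intro continuous_intros is_norm_continuous assms matrix_vector_mult_linear_continuous_on)
    show "G (a *\<^sub>R z) = \<bar>a\<bar> * G z" for a z
    proof -
      have "N1 (a *\<^sub>R z) = \<bar>a\<bar> * N1 z" "N2 (a *\<^sub>R z) = \<bar>a\<bar> * N2 z"
        using assms(2,3) unfolding is_norm_def by auto
      then show ?thesis
        unfolding G_def by (simp add: matrix_vector_mult_scaleR algebra_simps)
    qed
    show "G z > 0" if "z \<noteq> 0" for z
    proof (cases "A *v z = 0")
      case True
      then show ?thesis using less[OF kernel_l0norm] that unfolding G_def by simp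
    next
      case False
      then show ?thesis using le[of z] unfolding G_def by (simp add: add_nonneg_pos)
    qed
  qed blast
  show thesis
  proof
    show "\<mu> * c > 0" using c \<open>\<mu> > 0\<close> by simp
    fix z
    define s where "s = norm (A *v z - b)"
    \<comment> \<open>The tangent to the quadratic term at \<open>s = \<mu>\<close> has slope \<mu>,
      the weight of \<open>N1 z - N2 z\<close>. Hence \<mu> factors out and the bound on
      \<open>G\<close> applies.\<close>
    have "0 \<le> (s - \<mu>)\<^sup>2" by simp
    then have young: "1 / 2 * s\<^sup>2 \<ge> \<mu> * s - \<mu>\<^sup>2 / 2"
      by (simp add: power2_eq_square algebra_simps)
    have "norm (A *v z) \<le> s + norm b"
      unfolding s_def by (metis diff_add_cancel norm_triangle_ineq)
    then have "c * norm z \<le> N1 z - N2 z + s + norm b"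
      using c(2)[of z] unfolding G_def by simp
    then have "\<mu> * (c * norm z) \<le> \<mu> * (N1 z - N2 z + s + norm b)"
      using \<open>\<mu> > 0\<close> by simp
    with young have "\<mu> * c * norm z - (\<mu> * norm b + \<mu>\<^sup>2 / 2) \<le>
        1 / 2 * s\<^sup>2 + \<mu> * N1 z - \<mu> * N2 z"
      by (simp add: algebra_simps)
    then show "ereal (\<mu> * c * norm z - (\<mu> * norm b + \<mu>\<^sup>2 / 2)) \<le>
        J_fun A b \<mu> \<mu> (\<lambda>z. ereal (N1 z)) (\<lambda>z. ereal (N2 z)) z"
      unfolding J_fun_def s_def by simp
  qed
qed

theorem proposition4p2:
  fixes A :: "real ^ 'n ^ 'm" and b :: "real ^ 'm"
    and \<mu>1 \<mu>2 :: real
    and H1 H2 :: "real ^ 'n \<Rightarrow> ereal"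
  assumes "\<mu>1 \<ge> \<mu>2" and "\<mu>2 > 0"
    and "proper_fun H1" and "closed_fun H1" and "convex_fun H1"
    and "proper_fun H2" and "closed_fun H2" and "convex_fun H2"
    and "\<exists>\<rho>. is_norm \<rho> \<and> (\<forall>z. 0 \<le> H2 z \<and> H2 z \<le> min (ereal (\<rho> z)) (H1 z))"
    and "(\<mu>1 > \<mu>2 \<and> level_bounded H1) \<or>
         (\<mu>1 = \<mu>2 \<and> is_ereal_norm H1 \<and> is_ereal_norm H2 \<and>
            (\<forall>z. l0norm z \<ge> r_col A + 1 \<longrightarrow> H1 z > H2 z))"
  shows "coercive (J_fun A b \<mu>1 \<mu>2 H1 H2)"
proof -
  from assms(9) obtain \<rho> where "\<forall>z. 0 \<le> H2 z \<and> H2 z \<le> min (ereal (\<rho> z)) (H1 z)"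
    by blast
  then have \<rho>: "\<And>z. 0 \<le> H2 z" "\<And>z. H2 z \<le> ereal (\<rho> z)" "\<And>z. H2 z \<le> H1 z"
    by auto
  \<comment> \<open>The norm \<open>\<rho>\<close> bounds \<open>H2\<close> by finite values, so
    \<open>H2\<close> is real-valued and no difference of infinities occurs in
    \<open>J_fun\<close>.\<close>
  define h2 where "h2 z = real_of_ereal (H2 z)" for z
  have "H2 z = ereal (h2 z)" for z
    using \<rho>(1,2)[of z] unfolding h2_def by (cases "H2 z") auto
  then have H2: "H2 = (\<lambda>z. ereal (h2 z))" by auto
  have H1_nonneg: "0 \<le> H1 z" for z using \<rho>(1,3)[of z] by (rule order_trans)
  have "\<mu>1 > 0" using assms(1,2) by linarith
  \<comment> \<open>\<open>H2\<close> enters with a minus sign, so closedness of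
    \<open>J_fun\<close> calls for upper semicontinuity of \<open>H2\<close>; convexity together
    with finiteness gives full continuity.\<close>
  have "continuous_on UNIV h2"
    using assms(8) convex_fun_ereal_imp_convex_on[of h2] unfolding H2
    by (intro convex_on_continuous) auto
  then have closed: "closed_fun (J_fun A b \<mu>1 \<mu>2 H1 H2)"
    unfolding H2 by (rule J_fun_closed[OF assms(4) \<open>\<mu>1 > 0\<close> H1_nonneg])
  have proper: "proper_fun (J_fun A b \<mu>1 \<mu>2 H1 H2)"
    unfolding H2 by (rule J_fun_proper[OF assms(3) \<open>\<mu>1 > 0\<close> H1_nonneg])
  obtain c d where "c > 0" "\<And>z. J_fun A b \<mu>1 \<mu>2 H1 H2 z \<ge> ereal (c * norm z - d)"
    using assms(10)
  proof (elim disjE conjE)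
    assume gt: "\<mu>2 < \<mu>1" and "level_bounded H1"
    then obtain c d where cd: "c > 0" "\<And>z. H1 z \<ge> ereal (c * norm z - d)"
      using level_bounded_convex_linear_growth assms(5) H1_nonneg by metis
    show thesis
    proof (rule that)
      show "(\<mu>1 - \<mu>2) * c > 0" using cd gt by simp
      fix z
      have "ereal ((\<mu>1 - \<mu>2) * (c * norm z - d)) \<le> J_fun A b \<mu>1 \<mu>2 H1 H2 z"
        unfolding H2 using \<rho>(1,3)[of z] cd(2)[of z] gt assms(2)
        by (intro J_fun_bound_strict) (auto simp: H2)
      then show "ereal ((\<mu>1 - \<mu>2) * c * norm z - (\<mu>1 - \<mu>2) * d) \<le> J_fun A b \<mu>1 \<mu>2 H1 H2 z"
        by (simp add: algebra_simps)
    qed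
  next
    assume eq: "\<mu>1 = \<mu>2" and norms: "is_ereal_norm H1" "is_ereal_norm H2"
      and less: "\<forall>z. r_col A + 1 \<le> l0norm z \<longrightarrow> H2 z < H1 z"
    from norms obtain N1 N2 where N: "is_norm N1" "H1 = (\<lambda>z. ereal (N1 z))"
      "is_norm N2" "H2 = (\<lambda>z. ereal (N2 z))"
      unfolding is_ereal_norm_def by blast
    have "N2 z \<le> N1 z" for z using \<rho>(3)[of z] N by simp
    moreover have "N2 z < N1 z" if "r_col A + 1 \<le> l0norm z" for z
      using less that N by simp
    ultimately show thesis
      using J_fun_bound_norms[of \<mu>1 N1 N2 A b] \<open>\<mu>1 > 0\<close> N that eq by metis
  qed
  then show ?thesis by (rule coercive_if_linear_bound[OF proper closed])
qed

end
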